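(* It holds that $\mathbb{T}\left(\frac12\right)\ge\frac12$.
   Context: There are $n\ge 1$ boxes with independent nonnegative rewards $v_1,\dots,v_n$ whose distributions have no point masses. $Z=\max_{i\in[n]}v_i$ (the prophet), normalized so that $\mathbb{E}[Z]=1$. The quantile function of $Z$ is $Q(p)=\sup\{x\mid \Pr[Z\le x]=p\}$ for $p\in[0,1]$ (values in $\mathbb{R}_{\ge0}\cup\{\infty\}$). Define $\mathbb{T}(p)=p\int_p^1 \frac{Q(q)}{q^2}\,dq$ for $p\in(0,1]$. *)

theory Defs
  imports "HOL-Probability.Probability"
begin

text \<open>Boxes are indexed by \<open>1, \<dots>, n\<close>; the value is meaningful for \<open>n \<ge> 1\<close>, since
  \<^term>\<open>Max {}\<close> is unspecified.\<close>

definition prophet :: "nat \<Rightarrow> (nat \<Rightarrow> 'a \<Rightarrow> real) \<Rightarrow> 'a \<Rightarrow> real" where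
  "prophet n v \<omega> = Max ((\<lambda>i. v i \<omega>) ` {1..n})"

text \<open>The argument \<open>x\<close> ranges over \<open>[0, \<infinity>]\<close>, so the value at \<open>p = 1\<close> is \<open>\<infinity>\<close> even when
  \<open>Z\<close> is unbounded and no real \<open>x\<close> is admissible. Negative values of \<open>Z\<close> are read as \<open>0\<close>,
  which is immaterial for \<open>Z \<ge> 0\<close> almost surely.\<close>

definition quantile :: "'a measure \<Rightarrow> ('a \<Rightarrow> real) \<Rightarrow> real \<Rightarrow> ennreal" where
  "quantile M Z p = Sup {x. measure M {\<omega> \<in> space M. ennreal (Z \<omega>) \<le> x} = p}"

text \<open>The integrand is nonnegative, so the integral is the one with values in \<open>[0, \<infinity>]\<close>;
  no integrability assumption is needed.\<close>

definition T_fun :: "'a measure \<Rightarrow> ('a \<Rightarrow> real) \<Rightarrow> real \<Rightarrow> ennreal" where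
  "T_fun M Z p = ennreal p * (\<integral>\<^sup>+ q\<in>{p..1}. (quantile M Z q / ennreal (q\<^sup>2)) \<partial>lborel)"

end

theory Submission
  imports Defs
begin

text \<open>Write \<open>F\<close> for the distribution function of \<open>Z\<close>. Continuity of \<open>F\<close> gives \<open>Q q \<ge> t\<close> whenever
  \<open>F t \<le> q\<close>, so \<open>Q q\<close> is at least the length of \<open>{t \<ge> 0. F t \<le> q}\<close>. By Tonelli, the integral of
  \<open>Q q / q\<^sup>2\<close> over \<open>[1/2, 1]\<close> is at least the integral over \<open>t \<ge> 0\<close> of \<open>1 / b - 1\<close> with
  \<open>b = max (1/2) (F t)\<close>. Since \<open>1 / b - 1 \<ge> 1 - F t\<close>, and \<open>1 - F t\<close> integrates to
  the expectation of \<open>Z\<close>, that integral is at least 1.\<close>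

text \<open>The truncated value \<open>ennreal x\<close> is the length of \<open>{0..<x}\<close>,
  which is empty for negative \<open>x\<close>; Tonelli then swaps \<open>x\<close> and
  \<open>t\<close>, which is where sigma-finiteness enters.\<close>

lemma nn_integral_layer_cake:
  fixes D :: "real measure"
  assumes "sigma_finite_measure D" and [measurable_cong]: "sets D = sets borel"
  shows "(\<integral>\<^sup>+ x. ennreal x \<partial>D) = (\<integral>\<^sup>+ t\<in>{0..}. emeasure D {t<..} \<partial>lborel)"
proof -
  interpret sigma_finite_measure D by fact
  interpret P: pair_sigma_finite D lborel ..
  have "(\<integral>\<^sup>+ x. ennreal x \<partial>D) = (\<integral>\<^sup>+ x. \<integral>\<^sup>+ t. indicator {0..} t * indicator {t<..} x \<partial>lborel \<partial>D)"
  proof (intro nn_integral_cong)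
    fix x :: real
    have "(\<integral>\<^sup>+ t. indicator {0..} t * indicator {t<..} x \<partial>lborel) =
      (\<integral>\<^sup>+ t. indicator {0..<x} t \<partial>lborel)"
      by (intro nn_integral_cong) (auto simp: indicator_def)
    also have "\<dots> = ennreal x"
      by (cases "0 \<le> x") (auto simp: ennreal_neg)
    finally show "ennreal x = (\<integral>\<^sup>+ t. indicator {0..} t * indicator {t<..} x \<partial>lborel)"
      by simp
  qed
  also have "\<dots> = (\<integral>\<^sup>+ t. \<integral>\<^sup>+ x. indicator {0..} t * indicator {t<..} x \<partial>D \<partial>lborel)"
    by (rule P.Fubini'[symmetric]) (simp add: indicator_def)
  also have "\<dots> = (\<integral>\<^sup>+ t\<in>{0..}. emeasure D {t<..} \<partial>lborel)"
    using assms(2) by (intro nn_integral_cong) (simp add: nn_integral_cmult mult.commute)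
  finally show ?thesis .
qed

lemma nn_integral_inverse_square_Icc:
  assumes "0 < b" "b \<le> c"
  shows "(\<integral>\<^sup>+ q\<in>{b..c}. ennreal (1 / q\<^sup>2) \<partial>lborel) = ennreal (1 / b - 1 / c)"
proof -
  have "((\<lambda>q. - 1 / q) has_real_derivative 1 / q\<^sup>2) (at q)" if "b \<le> q" for q :: real
    using that assms by (auto intro!: derivative_eq_intros simp: power2_eq_square)
  then have "(\<integral>\<^sup>+ q. ennreal (1 / q\<^sup>2) * indicator {b..c} q \<partial>lborel) = ennreal (- 1 / c - (- 1 / b))"
    using assms
    by (intro nn_integral_FTC_Icc) (auto intro!: has_field_derivative_at_within)
  then show ?thesis by simp
qed

context prob_space
begin

text \<open>Without atoms the distribution function is continuous. For \<open>q < 1\<close> it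
  exceeds \<open>q\<close> far out, so the intermediate value theorem gives some
  \<open>x \<ge> t\<close> at which it equals \<open>q\<close>, a competitor in the supremum that
  defines \<open>quantile M Z q\<close>.\<close>

lemma le_quantileI:
  assumes [measurable]: "random_variable borel Z"
    and atomless: "\<And>x. measure (distr M borel Z) {x} = 0"
    and "0 \<le> t" "cdf (distr M borel Z) t \<le> q" "q \<le> 1"
  shows "ennreal t \<le> quantile M Z q"
proof (cases "q = 1")
  case True
  \<comment> \<open>The level 1 need not be attained at any real point, but \<open>top\<close> is
    always admissible, so the quantile at 1 is infinite.\<close>
  have "measure M {\<omega> \<in> space M. ennreal (Z \<omega>) \<le> top} = q"
    using True by (simp add: prob_space)
  then have "top \<le> quantile M Z q"
    unfolding quantile_def by (intro Sup_upper) simp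
  then show ?thesis
    by (meson order_trans top_greatest)
next
  case False
  let ?D = "distr M borel Z"
  interpret D: real_distribution ?D by simp
  have "eventually (\<lambda>x. q < cdf ?D x) at_top"
    using False assms(5) by (intro order_tendstoD(1)[OF D.cdf_lim_at_top_prob]) simp
  then obtain N where N: "\<And>u. N \<le> u \<Longrightarrow> q < cdf ?D u"
    by (auto simp: eventually_at_top_linorder)
  define u where "u = max N t"
  have u: "t \<le> u" "q < cdf ?D u"
    using N by (auto simp: u_def)
  then obtain x where x: "t \<le> x" "cdf ?D x = q"
    using IVT[of "cdf ?D" t q u] assms(4) atomless by (auto simp: D.isCont_cdf)
  \<comment> \<open>Since \<open>0 \<le> t \<le> x\<close>, truncating negative values of
    \<open>Z\<close> to 0 leaves the event \<open>Z \<omega> \<le> x\<close> unchanged.\<close>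
  have "measure M {\<omega> \<in> space M. ennreal (Z \<omega>) \<le> ennreal x} = q"
    using x assms(3)
    by (auto simp: cdf_def measure_distr ennreal_le_iff vimage_def Int_def conj_commute)
  then have "ennreal x \<le> quantile M Z q"
    unfolding quantile_def by (intro Sup_upper) simp
  with x(1) show ?thesis
    by (meson ennreal_leI order_trans)
qed

lemma nn_integral_quantile_ge:
  assumes [measurable]: "random_variable borel Z"
    and atomless: "\<And>x. measure (distr M borel Z) {x} = 0"
  shows "(\<integral>\<^sup>+ \<omega>. ennreal (Z \<omega>) \<partial>M) \<le> (\<integral>\<^sup>+ q\<in>{1/2..1}. (quantile M Z q / ennreal (q\<^sup>2)) \<partial>lborel)"
proof -
  let ?D = "distr M borel Z"
  interpret D: real_distribution ?D by simp
  have [measurable]: "cdf ?D \<in> borel_measurable borel"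
    by (intro borel_measurable_mono monoI D.cdf_nondecreasing)
  \<comment> \<open>The weight \<open>1 / q\<^sup>2\<close> on the region
    \<open>1/2 \<le> q \<le> 1\<close>, \<open>0 \<le> t\<close>, \<open>cdf ?D t \<le> q\<close>.
    Integrating over \<open>q\<close> first brings out the tail of \<open>Z\<close>, over
    \<open>t\<close> first the quantile.\<close>
  define g :: "real \<Rightarrow> real \<Rightarrow> ennreal" where "g = (\<lambda>q t.
    ennreal (1 / q\<^sup>2) * indicator {1/2..1} q * (indicator {0..} t * indicator {cdf ?D t..} q))"
  have g_measurable: "case_prod g \<in> borel_measurable (lborel \<Otimes>\<^sub>M lborel)"
    unfolding g_def by (simp add: indicator_def)
  have "(\<integral>\<^sup>+ \<omega>. ennreal (Z \<omega>) \<partial>M) = (\<integral>\<^sup>+ x. ennreal x \<partial>?D)"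
    by (simp add: nn_integral_distr)
  also have "\<dots> = (\<integral>\<^sup>+ t\<in>{0..}. emeasure ?D {t<..} \<partial>lborel)"
    by (rule nn_integral_layer_cake) (simp_all add: D.sigma_finite_measure_axioms)
  also have "\<dots> \<le> (\<integral>\<^sup>+ t. \<integral>\<^sup>+ q. g q t \<partial>lborel \<partial>lborel)"
  proof (intro nn_integral_mono)
    fix t :: real
    \<comment> \<open>For fixed \<open>t \<ge> 0\<close>, the region is the interval
      \<open>{b..1}\<close> in \<open>q\<close>.\<close>
    define b where "b = max (1/2) (cdf ?D t)"
    have b: "1/2 \<le> b" "b \<le> 1" "cdf ?D t \<le> b"
      unfolding b_def using D.cdf_bounded_prob[of t] by auto
    \<comment> \<open>If \<open>cdf ?D t \<le> 1/2\<close>, the right side is 1. Otherwise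
      \<open>b = cdf ?D t\<close> and the difference of the two sides is
      \<open>(1 - b)\<^sup>2 / b\<close>.\<close>
    have "1 - cdf ?D t \<le> 1 / b - 1"
    proof (cases "cdf ?D t \<le> 1/2")
      case True
      then have "1 / b = 2" by (simp add: b_def)
      then show ?thesis
        using D.cdf_nonneg[of t] by simp
    next
      case False
      then have "b = cdf ?D t" by (simp add: b_def)
      moreover have "2 * b \<le> 1 + b * b"
        using zero_le_square[of "b - 1"] by (simp add: algebra_simps)
      ultimately show ?thesis
        using b by (simp add: field_simps)
    qed
    moreover have "emeasure ?D {t<..} = ennreal (1 - cdf ?D t)"
    proof -
      have "{t<..} = space ?D - {..t}" by auto
      then have "measure ?D {t<..} = 1 - cdf ?D t"
        using D.prob_compl[of "{..t}"] by (simp add: cdf_def)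
      then show ?thesis by (simp add: D.emeasure_eq_measure)
    qed
    ultimately have "emeasure ?D {t<..} * indicator {0..} t \<le> ennreal (1 / b - 1) * indicator {0..} t"
      by (intro mult_right_mono) (auto intro: ennreal_leI)
    also have "\<dots> = (\<integral>\<^sup>+ q\<in>{b..1}. ennreal (1 / q\<^sup>2) \<partial>lborel) * indicator {0..} t"
      using b by (subst nn_integral_inverse_square_Icc) auto
    also have "\<dots> = (\<integral>\<^sup>+ q. ennreal (1 / q\<^sup>2) * indicator {b..1} q * indicator {0..} t \<partial>lborel)"
      by (rule nn_integral_multc[symmetric]) simp
    also have "\<dots> = (\<integral>\<^sup>+ q. g q t \<partial>lborel)"
      unfolding g_def b_def by (intro nn_integral_cong) (auto simp: indicator_def)
    finally show "emeasure ?D {t<..} * indicator {0..} t \<le> (\<integral>\<^sup>+ q. g q t \<partial>lborel)" .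
  qed
  also have "\<dots> = (\<integral>\<^sup>+ q. \<integral>\<^sup>+ t. g q t \<partial>lborel \<partial>lborel)"
    by (rule lborel_pair.Fubini'[OF g_measurable])
  also have "\<dots> \<le> (\<integral>\<^sup>+ q\<in>{1/2..1}. (quantile M Z q / ennreal (q\<^sup>2)) \<partial>lborel)"
  proof (intro nn_integral_mono)
    fix q :: real
    show "(\<integral>\<^sup>+ t. g q t \<partial>lborel) \<le> quantile M Z q / ennreal (q\<^sup>2) * indicator {1/2..1} q"
    proof (cases "q \<in> {1/2..1}")
      case False
      then show ?thesis by (simp add: g_def)
    next
      case q: True
      \<comment> \<open>If the quantile is a finite \<open>r\<close>, every \<open>t\<close> counted
        on the left lies in \<open>{0..r}\<close>; if it is infinite, nothing is to be
        shown.\<close>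
      have "(\<integral>\<^sup>+ t. indicator {0..} t * indicator {cdf ?D t..} q \<partial>lborel) \<le> quantile M Z q"
      proof (cases "quantile M Z q")
        case (real r)
        have "t \<le> r" if "0 \<le> t" "cdf ?D t \<le> q" for t
          using le_quantileI[OF assms that] q real by simp
        then have "(\<integral>\<^sup>+ t. indicator {0..} t * indicator {cdf ?D t..} q \<partial>lborel) \<le>
          (\<integral>\<^sup>+ t. indicator {0..r} t \<partial>lborel)"
          by (intro nn_integral_mono) (auto simp: indicator_def)
        with real show ?thesis by simp
      qed simp
      then have "ennreal (1 / q\<^sup>2) * (\<integral>\<^sup>+ t. indicator {0..} t * indicator {cdf ?D t..} q \<partial>lborel) \<le>
        ennreal (1 / q\<^sup>2) * quantile M Z q"
        by (rule mult_left_mono) simp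
      also have "\<dots> = quantile M Z q / ennreal (q\<^sup>2)"
        using q by (simp add: divide_ennreal_def inverse_ennreal inverse_eq_divide mult.commute)
      finally show ?thesis
        using q by (simp add: g_def nn_integral_cmult indicator_def)
    qed
  qed
  finally show ?thesis .
qed

end

theorem claim8:
  fixes M :: "'a measure" and n :: nat and v :: "nat \<Rightarrow> 'a \<Rightarrow> real"
  assumes "prob_space M"
    and "n \<ge> 1"
    and "prob_space.indep_vars M (\<lambda>_. borel) v {1..n}"
    and "\<And>i. i \<in> {1..n} \<Longrightarrow> AE \<omega> in M. 0 \<le> v i \<omega>"
    and "\<And>i x. i \<in> {1..n} \<Longrightarrow> measure (distr M borel (v i)) {x} = 0"
    and "prob_space.expectation M (prophet n v) = 1"
  shows "T_fun M (prophet n v) (1/2) \<ge> 1/2"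
proof -
  interpret prob_space M by fact
  let ?Z = "prophet n v"
  have v_measurable: "v i \<in> borel_measurable M" if "i \<in> {1..n}" for i
    using assms(3) that by (auto simp: indep_vars_def)
  have "(\<lambda>\<omega>. Max ((\<lambda>i. v i \<omega>) ` {1..n})) \<in> borel_measurable M"
    using v_measurable assms(2) by (intro borel_measurable_Max) auto
  then have Z_measurable [measurable]: "?Z \<in> borel_measurable M"
    by (simp add: prophet_def[abs_def])
  have atomless: "measure (distr M borel ?Z) {x} = 0" for x
  proof -
    \<comment> \<open>The maximum is attained, so \<open>?Z \<omega> = x\<close> forces
      \<open>v i \<omega> = x\<close> for some \<open>i\<close>: a finite union of null
      events.\<close>
    have "AE \<omega> in M. v i \<omega> \<noteq> x" if i: "i \<in> {1..n}" for i
    proof -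
      have [measurable]: "v i \<in> borel_measurable M" using v_measurable i by simp
      have "prob {\<omega> \<in> space M. v i \<omega> = x} = 0"
        using assms(5)[OF i, of x] by (simp add: measure_distr vimage_def Int_def conj_commute)
      then show ?thesis
        by (subst AE_iff_measurable[OF _ refl]) (auto simp: emeasure_eq_measure)
    qed
    then have "AE \<omega> in M. \<forall>i\<in>{1..n}. v i \<omega> \<noteq> x"
      by (intro AE_finite_allI) auto
    then have "AE \<omega> in M. ?Z \<omega> \<noteq> x"
    proof eventually_elim
      case (elim \<omega>)
      have "?Z \<omega> \<in> (\<lambda>i. v i \<omega>) ` {1..n}"
        unfolding prophet_def using assms(2) by (intro Max_in) auto
      with elim show ?case by auto
    qed
    then have "prob {\<omega> \<in> space M. ?Z \<omega> = x} = 0"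
      by (subst (asm) AE_iff_measurable[OF _ refl]) (auto simp: emeasure_eq_measure)
    then show ?thesis
      by (simp add: measure_distr vimage_def Int_def conj_commute)
  qed
  have "AE \<omega> in M. 0 \<le> v 1 \<omega>" using assms(2,4) by simp
  then have nonneg: "AE \<omega> in M. 0 \<le> ?Z \<omega>"
  proof eventually_elim
    case (elim \<omega>)
    have "v 1 \<omega> \<le> ?Z \<omega>"
      unfolding prophet_def using assms(2) by (intro Max_ge) auto
    with elim show ?case by simp
  qed
  \<comment> \<open>The Bochner integral of a non-integrable function is 0 by convention, so an
    expectation of 1 forces integrability.\<close>
  have "integrable M ?Z"
    using assms(6) not_integrable_integral_eq[of M ?Z] by linarith
  then have "(\<integral>\<^sup>+ \<omega>. ennreal (?Z \<omega>) \<partial>M) = 1"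
    using nn_integral_eq_integral[of M ?Z] nonneg assms(6) by simp
  then have "1 \<le> (\<integral>\<^sup>+ q\<in>{1/2..1}. (quantile M ?Z q / ennreal (q\<^sup>2)) \<partial>lborel)"
    using nn_integral_quantile_ge[OF Z_measurable atomless] by simp
  then have "ennreal (1/2) * 1 \<le> T_fun M ?Z (1/2)"
    unfolding T_fun_def by (intro mult_left_mono) auto
  moreover have "ennreal (1/2) = 1/2"
    using divide_ennreal[of 1 2] by simp
  ultimately show ?thesis by simp
qed

end
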